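(* Let $\{K_n:n\ge1\}$ be a sequence of nonempty compact subsets of $\mathcal X$ and let $p\in[1,\infty)$. Assume that the collection $\{X^n_s : s\in S_n,\ n\ge 1\}$ of $\mathcal X$-valued random elements is $(\nu_n)$-$\mathrm{CUI}(p)$ with respect to $\{K_n\}$. If $$\lim_{n\to\infty}\|K_n\|\,\nu_n(S_n)=0,$$ then $$\lim_{n\to\infty}\mathbb E\left\|\int_{S_n}X^n_s\,\nu_n(\mathrm ds)\right\|^p=0.$$
   Context: Standing setting: $(\mathcal X,\|\cdot\|)$ is a separable Banach space with Borel $\sigma$-algebra $\mathcal B(\mathcal X)$; $(\Omega,\mathcal F,\mathbb P)$ is a complete probability space; an $\mathcal X$-valued random element is an $\mathcal F/\mathcal B(\mathcal X)$-measurable map $\Omega\to\mathcal X$. $\{(S_n,\mathcal S_n,\nu_n):n\ge1\}$ is a family of finite measure spaces with $\sup_{n\ge1}\nu_n(S_n)=:C_\nu\in(0,\infty)$. Integrals of $\mathcal X$-valued functions are Bochner integrals. For a nonempty compact $K\subseteq\mathcal X$, $\|K\|:=\max\{\|x\|:x\in K\}$. Definition ($(\nu_n)$-$\mathrm{CUI}(p)$ w.r.t. $\{K_n\}$), for $p\in(0,\infty)$ and compact sets $K_n\subset\mathcal X$: a collection $\{X^n_s:s\in S_n,n\ge1\}$ of $\mathcal X$-valued random elements is $(\nu_n)$-$\mathrm{CUI}(p)$ w.r.t. $\{K_n\}$ if (a) the map $(\omega,s)\mapsto X^n_s(\omega)$ is $\mathcal F\otimes\mathcal S_n/\mathcal B(\mathcal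 X)$-measurable for every $n\ge1$; and (b) $\lim_{n\to\infty}\mathbb E\int_{S_n}\|X^n_s\|^p\,\mathbf 1_{\{X^n_s\notin K_n\}}\,\nu_n(\mathrm ds)=0$. Under this condition with $p\ge1$, there is $n_0$ such that for all $n\ge n_0$ the Bochner integral $\int_{S_n}X^n_s\,\nu_n(\mathrm ds)$ exists almost surely; the limit is understood along $n\ge n_0$. *)

theory Defs
  imports "HOL-Probability.Probability"
begin

definition set_norm :: "'a::real_normed_vector set \<Rightarrow> real" where
  "set_norm K = (GREATEST r. r \<in> norm ` K)"

lemma set_norm_attained:
  assumes "compact K" "K \<noteq> {}"
  shows "set_norm K \<in> norm ` K" and "x \<in> K \<Longrightarrow> norm x \<le> set_norm K"
proof -
  have "compact (norm ` K)" "norm ` K \<noteq> {}"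
    using assms by (auto intro!: compact_continuous_image continuous_intros)
  then obtain m where m: "m \<in> norm ` K" "\<And>r. r \<in> norm ` K \<Longrightarrow> r \<le> m"
    using compact_attains_sup by metis
  then have "set_norm K = m"
    unfolding set_norm_def by (rule Greatest_equality)
  with m show "set_norm K \<in> norm ` K" and "x \<in> K \<Longrightarrow> norm x \<le> set_norm K"
    by auto
qed

text \<open>
  The expectation in the second clause is taken in the extended nonnegative reals, since it may be
  infinite for finitely many \<open>n\<close>. The sets \<open>S\<^sub>n\<close>, which may differ with \<open>n\<close>, are the spaces of the
  measures \<open>\<nu> n\<close>; they share an ambient type, and all indices start at 1.
\<close>

definition CUI ::
  "'w measure \<Rightarrow> (nat \<Rightarrow> 's measure) \<Rightarrow> real \<Rightarrow> (nat \<Rightarrow> 'a::real_normed_vector set)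
    \<Rightarrow> (nat \<Rightarrow> 's \<Rightarrow> 'w \<Rightarrow> 'a) \<Rightarrow> bool" where
  "CUI M \<nu> p K X \<longleftrightarrow>
    (\<forall>n\<ge>1. (\<lambda>(\<omega>, s). X n s \<omega>) \<in> M \<Otimes>\<^sub>M \<nu> n \<rightarrow>\<^sub>M borel) \<and>
    (\<lambda>n. \<integral>\<^sup>+\<omega>. (\<integral>\<^sup>+s. ennreal (norm (X n s \<omega>) powr p) * indicator (- K n) (X n s \<omega>) \<partial>\<nu> n) \<partial>M)
      \<longlonglongrightarrow> 0"

end

theory Submission
  imports Defs
begin

text \<open>
  For a fixed outcome, split the integral over \<open>S\<^sub>n\<close> according to whether \<open>X\<^sup>n\<^sub>s \<in> K\<^sub>n\<close>. The first part is
  at most \<open>\<parallel>K\<^sub>n\<parallel> \<nu>\<^sub>n(S\<^sub>n)\<close>. On the second part \<open>y \<le> t + t\<^bsup>1-p\<^esup> y\<^bsup>p\<^esup>\<close> for every \<open>t > 0\<close>, and choosing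
  \<open>t = I\<^bsup>1/p\<^esup>\<close>, with \<open>I\<close> the integral of \<open>\<parallel>X\<^sup>n\<^sub>s\<parallel>\<^bsup>p\<^esup>\<close> over that part, bounds it by
  \<open>(\<nu>\<^sub>n(S\<^sub>n) + 1) I\<^bsup>1/p\<^esup>\<close>. Raising to the power \<open>p\<close> and taking expectations gives the claim.
\<close>

text \<open>For \<open>y > t\<close> the ratio \<open>y / t\<close> exceeds 1, so raising it to the
  power \<open>p\<close> does not decrease it. This stands in for Hoelder's inequality, with
  \<open>t\<close> left free to be optimised after integration.\<close>

lemma le_add_powr:
  fixes y t p :: real
  assumes "0 \<le> y" "0 < t" "1 \<le> p"
  shows "y \<le> t + t powr (1 - p) * y powr p"
proof (cases "y \<le> t")
  case True
  then show ?thesis by (simp add: add_increasing2)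
next
  case False
  then have "1 \<le> y / t" using assms by (simp add: field_simps)
  then have "y / t \<le> (y / t) powr p"
    using assms powr_mono[of 1 p "y / t"] by simp
  then have "y \<le> t * (y / t) powr p"
    using assms by (simp add: field_simps)
  also have "\<dots> = t powr (1 - p) * y powr p"
    using assms by (simp add: powr_divide powr_diff)
  finally show ?thesis using assms by simp
qed

lemma powr_add_le_double:
  fixes x y p :: real
  assumes "0 \<le> x" "0 \<le> y" "0 \<le> p"
  shows "(x + y) powr p \<le> 2 powr p * (x powr p + y powr p)"
proof -
  have "(x + y) powr p \<le> (2 * max x y) powr p"
    using assms by (intro powr_mono2) auto
  also have "\<dots> = 2 powr p * max x y powr p"
    using assms by (simp add: powr_mult)
  also have "\<dots> \<le> 2 powr p * (x powr p + y powr p)"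
    by (intro mult_left_mono) (auto simp: max_def)
  finally show ?thesis .
qed

context finite_measure
begin

text \<open>Both conclusions come from one pointwise majorant of \<open>norm (f s)\<close>, which is
  integrable because constants are integrable over a finite measure.\<close>

lemma integrable_of_integrable_powr_outside:
  fixes f :: "'a \<Rightarrow> 'b::{banach, second_countable_topology}"
  assumes [measurable]: "f \<in> borel_measurable M" and K: "\<And>x. x \<in> K \<Longrightarrow> norm x \<le> a"
    and a: "0 \<le> a" and p: "1 \<le> p"
    and int: "integrable M (\<lambda>s. norm (f s) powr p * indicator (- K) (f s))"
  shows "integrable M f"
    and "0 < t \<Longrightarrow> norm (\<integral>s. f s \<partial>M) \<le> a * measure M (space M) + t * measure M (space M)
      + t powr (1 - p) * (\<integral>s. norm (f s) powr p * indicator (- K) (f s) \<partial>M)"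
proof -
  let ?g = "\<lambda>s. norm (f s) powr p * indicator (- K) (f s)"
  \<comment> \<open>On \<open>K\<close> the summand \<open>a\<close> suffices; off \<open>K\<close>
    the remaining two do, by \<open>le_add_powr\<close>.\<close>
  have bound: "norm (f s) \<le> a + t + t powr (1 - p) * ?g s" if "0 < t" for s t
    using le_add_powr[of "norm (f s)" t p] K[of "f s"] that a p by (cases "f s \<in> K") auto
  have int': "integrable M (\<lambda>s. a + t + t powr (1 - p) * ?g s)" for t
    using int by simp
  \<comment> \<open>Any positive \<open>t\<close> gives a majorant; 1 is an arbitrary
    choice.\<close>
  show f: "integrable M f"
    by (rule Bochner_Integration.integrable_bound[OF int'[of 1]])
      (use bound[of 1] in \<open>auto intro!: AE_I2 intro: order_trans[OF _ abs_ge_self]\<close>)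
  assume t: "0 < t"
  have "norm (\<integral>s. f s \<partial>M) \<le> (\<integral>s. norm (f s) \<partial>M)"
    by (rule integral_norm_bound)
  also have "\<dots> \<le> (\<integral>s. a + t + t powr (1 - p) * ?g s \<partial>M)"
    using f int' bound[OF t] by (intro integral_mono) auto
  also have "\<dots> = a * measure M (space M) + t * measure M (space M) + t powr (1 - p) * (\<integral>s. ?g s \<partial>M)"
    using int by (simp add: distrib_left distrib_right mult.commute)
  finally show "norm (\<integral>s. f s \<partial>M) \<le> \<dots>" .
qed

lemma norm_integral_le_outside:
  fixes f :: "'a \<Rightarrow> 'b::{banach, second_countable_topology}"
  assumes f: "f \<in> borel_measurable M" and K: "\<And>x. x \<in> K \<Longrightarrow> norm x \<le> a"
    and a: "0 \<le> a" and p: "1 \<le> p"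
    and int: "integrable M (\<lambda>s. norm (f s) powr p * indicator (- K) (f s))"
  shows "norm (\<integral>s. f s \<partial>M) \<le> a * measure M (space M) + (measure M (space M) + 1) *
    (\<integral>s. norm (f s) powr p * indicator (- K) (f s) \<partial>M) powr (1 / p)"
proof -
  define c J where "c = measure M (space M)"
    and "J = (\<integral>s. norm (f s) powr p * indicator (- K) (f s) \<partial>M)"
  have c: "0 \<le> c" by (simp add: c_def)
  have J: "0 \<le> J" unfolding J_def by (intro Bochner_Integration.integral_nonneg) simp
  have bound: "norm (\<integral>s. f s \<partial>M) \<le> a * c + t * c + t powr (1 - p) * J" if "0 < t" for t
    unfolding c_def J_def
    by (rule integrable_of_integrable_powr_outside(2)[OF f K a p int that])
  have "norm (\<integral>s. f s \<partial>M) \<le> a * c + (c + 1) * J powr (1 / p)"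
  proof (cases "J = 0")
    case True
    \<comment> \<open>Here \<open>J powr (1 / p)\<close> is 0 and not an admissible
      \<open>t\<close>, so \<open>t\<close> is sent to 0 instead. The value
      \<open>e / (c + 1)\<close> keeps \<open>t * c\<close> below \<open>e\<close> and stays well
      defined when \<open>c = 0\<close>.\<close>
    have "norm (\<integral>s. f s \<partial>M) \<le> a * c + e" if "0 < e" for e
    proof -
      have "norm (\<integral>s. f s \<partial>M) \<le> a * c + e / (c + 1) * c"
        using bound[of "e / (c + 1)"] True that c by simp
      also have "e / (c + 1) * c \<le> e" using that c by (simp add: field_simps)
      finally show ?thesis by simp
    qed
    then show ?thesis using True by (auto intro: field_le_epsilon)
  next
    case False
    then have "0 < J" using J by simp
    define t where "t = J powr (1 / p)"
    have t: "0 < t" "J = t powr p" using \<open>0 < J\<close> p by (simp_all add: t_def powr_powr)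
    \<comment> \<open>This \<open>t\<close> balances the bound: the last term becomes
      \<open>t\<close> itself, so together with \<open>t * c\<close> it gives
      \<open>(c + 1) * t\<close>.\<close>
    have "t powr (1 - p) * J = t" using t(1) by (simp add: t(2) flip: powr_add)
    then show ?thesis using bound[OF t(1)] by (simp add: t_def[symmetric] algebra_simps)
  qed
  then show ?thesis by (simp add: c_def J_def)
qed

text \<open>Passes from the extended nonnegative integral used in \<open>CUI\<close> to a real one,
  to which the estimates above apply.\<close>

lemma integrable_powr_outside:
  fixes f :: "'a \<Rightarrow> 'b::{banach, second_countable_topology}"
  assumes [measurable]: "f \<in> borel_measurable M" "K \<in> sets borel"
    and fin: "(\<integral>\<^sup>+s. ennreal (norm (f s) powr p) * indicator (- K) (f s) \<partial>M) < \<infinity>"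
  shows "integrable M (\<lambda>s. norm (f s) powr p * indicator (- K) (f s))"
    and "(\<integral>\<^sup>+s. ennreal (norm (f s) powr p) * indicator (- K) (f s) \<partial>M)
      = ennreal (\<integral>s. norm (f s) powr p * indicator (- K) (f s) \<partial>M)"
proof -
  have eq: "(\<integral>\<^sup>+s. ennreal (norm (f s) powr p) * indicator (- K) (f s) \<partial>M)
      = (\<integral>\<^sup>+s. ennreal (norm (f s) powr p * indicator (- K) (f s)) \<partial>M)"
    by (intro nn_integral_cong) (simp add: ennreal_mult ennreal_indicator)
  show int: "integrable M (\<lambda>s. norm (f s) powr p * indicator (- K) (f s))"
    using fin unfolding eq by (intro integrableI_nonneg) auto
  show "(\<integral>\<^sup>+s. ennreal (norm (f s) powr p) * indicator (- K) (f s) \<partial>M)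
      = ennreal (\<integral>s. norm (f s) powr p * indicator (- K) (f s) \<partial>M)"
    unfolding eq by (intro nn_integral_eq_integral[OF int]) auto
qed

text \<open>The form to be integrated over outcomes: linear in the tail integral, with a coefficient
  depending only on \<open>C\<close> and \<open>p\<close>, hence uniform in n. In the extended reals
  it also covers an infinite tail integral, where the right side is infinite.\<close>

lemma norm_integral_powr_le_outside:
  fixes f :: "'a \<Rightarrow> 'b::{banach, second_countable_topology}"
  assumes f: "f \<in> borel_measurable M" and K: "K \<in> sets borel" "\<And>x. x \<in> K \<Longrightarrow> norm x \<le> a"
    and a: "0 \<le> a" and p: "1 \<le> p" and C: "measure M (space M) \<le> C"
  shows "ennreal (norm (\<integral>s. f s \<partial>M) powr p)
    \<le> ennreal (2 powr p * (a * measure M (space M)) powr p) + ennreal (2 powr p * (C + 1) powr p) *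
      (\<integral>\<^sup>+s. ennreal (norm (f s) powr p) * indicator (- K) (f s) \<partial>M)" (is "?L \<le> ?A + ?B * ?I")
proof (cases "?I < \<infinity>")
  case False
  \<comment> \<open>The coefficient must be nonzero, since \<open>0 * top = 0\<close> in
    \<open>ennreal\<close>.\<close>
  have "0 \<le> C" using C measure_nonneg[of M "space M"] by linarith
  then have "?B \<noteq> 0" by simp
  moreover have "?I = top" using False by (simp add: not_less top_unique)
  ultimately have "?B * ?I = top" by (simp add: ennreal_mult_top)
  then show ?thesis by (simp only: add_top) simp
next
  case True
  note I = integrable_powr_outside[OF f K(1) True]
  define c J where "c = measure M (space M)"
    and "J = (\<integral>s. norm (f s) powr p * indicator (- K) (f s) \<partial>M)"
  have c: "0 \<le> c" "c \<le> C" using C by (simp_all add: c_def)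
  have J: "0 \<le> J" unfolding J_def by (intro Bochner_Integration.integral_nonneg) simp
  have "norm (\<integral>s. f s \<partial>M) powr p \<le> (a * c + (c + 1) * J powr (1 / p)) powr p"
    using norm_integral_le_outside[OF f K(2) a p I(1)] p
    by (intro powr_mono2) (auto simp: c_def J_def)
  also have "\<dots> \<le> 2 powr p * ((a * c) powr p + ((c + 1) * J powr (1 / p)) powr p)"
    using a c p by (intro powr_add_le_double) auto
  \<comment> \<open>The outer power cancels the root, which makes the bound linear in
    \<open>J\<close>.\<close>
  also have "((c + 1) * J powr (1 / p)) powr p = (c + 1) powr p * J"
    using c J p by (simp add: powr_mult powr_powr)
  also have "2 powr p * ((a * c) powr p + (c + 1) powr p * J)
      \<le> 2 powr p * ((a * c) powr p + (C + 1) powr p * J)"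
    using c J p by (intro mult_left_mono add_left_mono mult_right_mono powr_mono2) auto
  finally have "norm (\<integral>s. f s \<partial>M) powr p \<le> 2 powr p * (a * c) powr p + 2 powr p * (C + 1) powr p * J"
    by (simp add: algebra_simps)
  then have "?L \<le> ennreal (2 powr p * (a * c) powr p + 2 powr p * (C + 1) powr p * J)"
    by (rule ennreal_leI)
  also have "\<dots> = ?A + ?B * ennreal J"
    using J by (simp add: ennreal_mult c_def)
  finally show ?thesis by (simp add: I(2) J_def)
qed

end

theorem corollary3p3:
  fixes M :: "'w measure"
    and \<nu> :: "nat \<Rightarrow> 's measure"
    and X :: "nat \<Rightarrow> 's \<Rightarrow> 'w \<Rightarrow> 'a::{banach, second_countable_topology}"
    and K :: "nat \<Rightarrow> 'a set"
    and p :: real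
  assumes "prob_space M" and "complete_measure M"
    and "\<And>n. n \<ge> 1 \<Longrightarrow> finite_measure (\<nu> n)"
    and "0 < (SUP n\<in>{1..}. emeasure (\<nu> n) (space (\<nu> n)))"
    and "(SUP n\<in>{1..}. emeasure (\<nu> n) (space (\<nu> n))) < \<infinity>"
    and "\<And>n. n \<ge> 1 \<Longrightarrow> compact (K n) \<and> K n \<noteq> {}"
    and "p \<ge> 1"
    and "\<And>n s. n \<ge> 1 \<Longrightarrow> s \<in> space (\<nu> n) \<Longrightarrow> X n s \<in> M \<rightarrow>\<^sub>M borel"
    and "CUI M \<nu> p K X"
    and "(\<lambda>n. set_norm (K n) * measure (\<nu> n) (space (\<nu> n))) \<longlonglongrightarrow> 0"
  shows "(\<forall>\<^sub>F n in sequentially. AE \<omega> in M. integrable (\<nu> n) (\<lambda>s. X n s \<omega>)) \<and>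
    (\<lambda>n. \<integral>\<^sup>+\<omega>. ennreal (norm (\<integral>s. X n s \<omega> \<partial>\<nu> n) powr p) \<partial>M) \<longlonglongrightarrow> 0"
proof
  interpret prob_space M by fact
  let ?c = "\<lambda>n. measure (\<nu> n) (space (\<nu> n))"
  let ?I = "\<lambda>n \<omega>. \<integral>\<^sup>+s. ennreal (norm (X n s \<omega>) powr p) * indicator (- K n) (X n s \<omega>) \<partial>\<nu> n"
  define C where "C = enn2real (SUP n\<in>{1..}. emeasure (\<nu> n) (space (\<nu> n)))"
  let ?B = "ennreal (2 powr p * (C + 1) powr p)"
  note fin = assms(3)
  have lim: "(\<lambda>n. \<integral>\<^sup>+\<omega>. ?I n \<omega> \<partial>M) \<longlonglongrightarrow> 0"
    and joint: "\<And>n. 1 \<le> n \<Longrightarrow> (\<lambda>(\<omega>, s). X n s \<omega>) \<in> M \<Otimes>\<^sub>M \<nu> n \<rightarrow>\<^sub>M borel"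
    using assms(9) by (auto simp: CUI_def)
  have meas: "(\<lambda>s. X n s \<omega>) \<in> borel_measurable (\<nu> n)" if "1 \<le> n" "\<omega> \<in> space M" for n \<omega>
    using measurable_Pair2[OF joint[OF that(1)] that(2)] by simp
  have K: "K n \<in> sets borel" if "1 \<le> n" for n
    using assms(6)[OF that] by (auto intro: borel_compact)
  have norm_K: "norm x \<le> set_norm (K n)" if "1 \<le> n" "x \<in> K n" for n x
    using set_norm_attained(2) assms(6)[OF that(1)] that(2) by blast
  have nonneg: "0 \<le> set_norm (K n)" if "1 \<le> n" for n
    using set_norm_attained(1)[of "K n"] assms(6)[OF that] by auto
  \<comment> \<open>Measurability of the inner integral in the outcome is the Tonelli statement for
    the sigma-finite measure \<open>\<nu> n\<close>, applied to the jointly measurable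
    integrand.\<close>
  have I_meas: "?I n \<in> borel_measurable M" if n: "1 \<le> n" for n
  proof -
    interpret \<nu>: finite_measure "\<nu> n" by (rule fin[OF n])
    note [measurable] = joint[OF n] K[OF n]
    show ?thesis by measurable
  qed
  have C: "?c n \<le> C" if n: "1 \<le> n" for n
    \<comment> \<open>\<open>enn2real\<close> sends \<open>top\<close> to 0, so its monotonicity
      here rests on the supremum being finite.\<close>
    unfolding C_def measure_def
    using n assms(5) by (intro enn2real_mono SUP_upper) auto

  \<comment> \<open>Convergence to 0 makes the expected tail integral eventually less than 1, so the
    tail integral is almost surely finite, and this forces integrability.\<close>
  show "\<forall>\<^sub>F n in sequentially. AE \<omega> in M. integrable (\<nu> n) (\<lambda>s. X n s \<omega>)"
    using order_tendstoD(2)[OF lim zero_less_one] eventually_ge_at_top[of 1]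
  proof eventually_elim
    case (elim n)
    interpret \<nu>: finite_measure "\<nu> n" by (rule fin[OF elim(2)])
    have "(\<integral>\<^sup>+\<omega>. ?I n \<omega> \<partial>M) \<noteq> \<infinity>"
      using elim(1) by auto
    then have "AE \<omega> in M. ?I n \<omega> \<noteq> \<infinity>"
      by (rule nn_integral_PInf_AE[OF I_meas[OF elim(2)]])
    then show ?case
    proof (rule AE_mp, intro AE_I2 impI)
      fix \<omega> assume \<omega>: "\<omega> \<in> space M" "?I n \<omega> \<noteq> \<infinity>"
      note m = meas[OF elim(2) \<omega>(1)]
      have "?I n \<omega> < \<infinity>" using \<omega>(2) by (simp add: less_top)
      note I = \<nu>.integrable_powr_outside(1)[OF m K[OF elim(2)] this]
      show "integrable (\<nu> n) (\<lambda>s. X n s \<omega>)"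
        by (rule \<nu>.integrable_of_integrable_powr_outside(1)[OF m _ nonneg[OF elim(2)] assms(7) I])
          (rule norm_K[OF elim(2)])
    qed
  qed

  have bound: "(\<integral>\<^sup>+\<omega>. ennreal (norm (\<integral>s. X n s \<omega> \<partial>\<nu> n) powr p) \<partial>M)
      \<le> ennreal (2 powr p * (set_norm (K n) * ?c n) powr p) + ?B * (\<integral>\<^sup>+\<omega>. ?I n \<omega> \<partial>M)"
    if n: "1 \<le> n" for n
  proof -
    interpret \<nu>: finite_measure "\<nu> n" by (rule fin[OF n])
    have "(\<integral>\<^sup>+\<omega>. ennreal (norm (\<integral>s. X n s \<omega> \<partial>\<nu> n) powr p) \<partial>M)
      \<le> (\<integral>\<^sup>+\<omega>. ennreal (2 powr p * (set_norm (K n) * ?c n) powr p) + ?B * ?I n \<omega> \<partial>M)"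
      \<comment> \<open>The pointwise estimate holds at every outcome, including those where the
        Bochner integral does not exist and takes its default value 0.\<close>
      by (intro nn_integral_mono \<nu>.norm_integral_powr_le_outside meas n K norm_K nonneg assms(7) C)
    also have "\<dots> = ennreal (2 powr p * (set_norm (K n) * ?c n) powr p) + ?B * (\<integral>\<^sup>+\<omega>. ?I n \<omega> \<partial>M)"
      using I_meas[OF n] by (simp add: nn_integral_add nn_integral_cmult emeasure_space_1)
    finally show ?thesis .
  qed
  \<comment> \<open>Nothing is assumed about \<open>K 0\<close> and \<open>\<nu> 0\<close>, so the
    base is known to be nonnegative only from index 1 on.\<close>
  have "(\<lambda>n. 2 powr p * (set_norm (K n) * ?c n) powr p) \<longlonglongrightarrow> 2 powr p * 0"
    using assms(7)
    by (intro tendsto_mult_left tendsto_zero_powrI[OF assms(10) tendsto_const]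
        eventually_mono[OF eventually_ge_at_top[of 1]] mult_nonneg_nonneg nonneg) auto
  from tendsto_ennrealI[OF this]
  have "(\<lambda>n. ennreal (2 powr p * (set_norm (K n) * ?c n) powr p)) \<longlonglongrightarrow> 0"
    by simp
  \<comment> \<open>Scaling preserves this limit in \<open>ennreal\<close> because the constant is
    finite.\<close>
  moreover have "(\<lambda>n. ?B * (\<integral>\<^sup>+\<omega>. ?I n \<omega> \<partial>M)) \<longlonglongrightarrow> ?B * 0"
    by (intro ennreal_tendsto_cmult lim) simp
  ultimately have "(\<lambda>n. ennreal (2 powr p * (set_norm (K n) * ?c n) powr p)
      + ?B * (\<integral>\<^sup>+\<omega>. ?I n \<omega> \<partial>M)) \<longlonglongrightarrow> 0 + ?B * 0"
    by (rule tendsto_add)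
  then have upper: "(\<lambda>n. ennreal (2 powr p * (set_norm (K n) * ?c n) powr p)
      + ?B * (\<integral>\<^sup>+\<omega>. ?I n \<omega> \<partial>M)) \<longlonglongrightarrow> 0"
    by simp
  show "(\<lambda>n. \<integral>\<^sup>+\<omega>. ennreal (norm (\<integral>s. X n s \<omega> \<partial>\<nu> n) powr p) \<partial>M) \<longlonglongrightarrow> 0"
    by (rule tendsto_sandwich[OF _ _ tendsto_const upper])
      (auto intro: eventually_mono[OF eventually_ge_at_top[of 1]] bound)
qed

end
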